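(* The class of IYB groups is closed under direct products: if $G_1$ and $G_2$ are IYB groups, then $G_1\times G_2$ is an IYB group.
   Context: $\mathrm{Fa}_n$ is the free abelian group (written multiplicatively) with basis $u_1,\dots,u_n$, and $\mathrm{Fa}_n\rtimes \mathrm{Sym}_n$ is the semidirect product for the natural action $\sigma(u_i)=u_{\sigma(i)}$, where $\mathrm{Sym}_n$ is the symmetric group of degree $n$. A finite group $G$ is an involutive Yang-Baxter (IYB) group if for some positive integer $n$ there is a map $\phi:\mathrm{Fa}_n\to \mathrm{Sym}_n$ such that $\{(a,\phi(a)) : a\in \mathrm{Fa}_n\}$ is a subgroup of $\mathrm{Fa}_n\rtimes \mathrm{Sym}_n$ and $G\cong\phi(\mathrm{Fa}_n)$. *)

theory Defs
  imports "HOL-Algebra.Sym_Groups" "HOL-Algebra.Free_Abelian_Groups"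
begin

definition semidirect_product ::
  "('a, 'm) monoid_scheme \<Rightarrow> ('b, 'k) monoid_scheme \<Rightarrow> ('b \<Rightarrow> 'a \<Rightarrow> 'a) \<Rightarrow> ('a \<times> 'b) monoid"
  where "semidirect_product N H act =
    \<lparr>carrier = carrier N \<times> carrier H,
     mult = (\<lambda>(a, s) (b, t). (a \<otimes>\<^bsub>N\<^esub> act s b, s \<otimes>\<^bsub>H\<^esub> t)),
     one = (\<one>\<^bsub>N\<^esub>, \<one>\<^bsub>H\<^esub>)\<rparr>"

(* The group operation of free_Abelian_group is written additively on the underlying
   finitely supported functions; frag_of i is the basis element u_i, i = 1, ..., n. *)
abbreviation Fa :: "nat \<Rightarrow> (nat \<Rightarrow>\<^sub>0 int) monoid"
  where "Fa n \<equiv> free_Abelian_group {1..n}"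

definition perm_action :: "(nat \<Rightarrow> nat) \<Rightarrow> (nat \<Rightarrow>\<^sub>0 int) \<Rightarrow> (nat \<Rightarrow>\<^sub>0 int)"
  where "perm_action \<sigma> = frag_extend (\<lambda>i. frag_of (\<sigma> i))"

definition Fa_rtimes_Sym :: "nat \<Rightarrow> ((nat \<Rightarrow>\<^sub>0 int) \<times> (nat \<Rightarrow> nat)) monoid"
  where "Fa_rtimes_Sym n = semidirect_product (Fa n) (sym_group n) perm_action"

definition IYB_group :: "('a, 'm) monoid_scheme \<Rightarrow> bool"
  where "IYB_group G \<longleftrightarrow> group G \<and> finite (carrier G) \<and>
    (\<exists>n>0. \<exists>\<phi> \<in> carrier (Fa n) \<rightarrow> carrier (sym_group n).
       subgroup {(a, \<phi> a) | a. a \<in> carrier (Fa n)} (Fa_rtimes_Sym n) \<and>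
       G \<cong> (sym_group n)\<lparr>carrier := \<phi> ` carrier (Fa n)\<rparr>)"

lemma group_semidirect_product:
  assumes "group N" "group H"
    and hom: "\<And>s. s \<in> carrier H \<Longrightarrow> act s \<in> hom N N"
    and one: "\<And>a. a \<in> carrier N \<Longrightarrow> act \<one>\<^bsub>H\<^esub> a = a"
    and mult: "\<And>s t a. s \<in> carrier H \<Longrightarrow> t \<in> carrier H \<Longrightarrow> a \<in> carrier N \<Longrightarrow>
                 act (s \<otimes>\<^bsub>H\<^esub> t) a = act s (act t a)"
  shows "group (semidirect_product N H act)"
proof -
  interpret N: group N by fact
  interpret H: group H by fact
  have cl: "act s a \<in> carrier N" if "s \<in> carrier H" "a \<in> carrier N" for s a
    using hom[OF that(1)] that(2) by (auto simp: hom_def)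
  have mu: "act s (a \<otimes>\<^bsub>N\<^esub> b) = act s a \<otimes>\<^bsub>N\<^esub> act s b"
    if "s \<in> carrier H" "a \<in> carrier N" "b \<in> carrier N" for s a b
    using hom[OF that(1)] that by (auto simp: hom_def)
  show ?thesis
  proof (rule groupI)
    fix x assume x: "x \<in> carrier (semidirect_product N H act)"
    then obtain a s where as: "x = (a, s)" "a \<in> carrier N" "s \<in> carrier H"
      by (auto simp: semidirect_product_def)
    let ?y = "(act (inv\<^bsub>H\<^esub> s) (inv\<^bsub>N\<^esub> a), inv\<^bsub>H\<^esub> s)"
    have "act (inv\<^bsub>H\<^esub> s) (inv\<^bsub>N\<^esub> a) \<otimes>\<^bsub>N\<^esub> act (inv\<^bsub>H\<^esub> s) a = act (inv\<^bsub>H\<^esub> s) \<one>\<^bsub>N\<^esub>"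
      using as by (simp flip: mu)
    also have "\<dots> = \<one>\<^bsub>N\<^esub>"
      using hom_one[OF hom[of "inv\<^bsub>H\<^esub> s"]] as assms(1) by simp
    finally show "\<exists>y\<in>carrier (semidirect_product N H act).
        y \<otimes>\<^bsub>semidirect_product N H act\<^esub> x = \<one>\<^bsub>semidirect_product N H act\<^esub>"
      using as cl by (intro bexI[of _ ?y]) (auto simp: semidirect_product_def)
  qed (auto simp: semidirect_product_def cl mu mult one N.m_assoc H.m_assoc)
qed

lemma perm_action_frag_of [simp]: "perm_action \<sigma> (frag_of i) = frag_of (\<sigma> i)"
  by (simp add: perm_action_def)

lemma perm_action_id: "perm_action id a = a"
  by (simp add: perm_action_def frag_expansion[symmetric])

lemma perm_action_comp: "perm_action (\<sigma> \<circ> \<tau>) a = perm_action \<sigma> (perm_action \<tau> a)"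
  unfolding perm_action_def
  using frag_extend_compose[of "\<lambda>i. frag_of (\<sigma> i)" \<tau> a] by (simp add: o_def)

lemma perm_action_hom:
  assumes "\<sigma> permutes {1..n}"
  shows "perm_action \<sigma> \<in> hom (Fa n) (Fa n)"
proof (rule homI)
  fix a assume "a \<in> carrier (Fa n)"
  then have "(\<Union>i\<in>Poly_Mapping.keys a. Poly_Mapping.keys (frag_of (\<sigma> i))) \<subseteq> {1..n}"
    using permutes_in_image[OF assms] by fastforce
  then show "perm_action \<sigma> a \<in> carrier (Fa n)"
    unfolding perm_action_def carrier_free_Abelian_group_iff
    by (rule order_trans[OF keys_frag_extend])
qed (simp add: perm_action_def free_Abelian_group_def frag_extend_add)

lemma group_Fa_rtimes_Sym: "group (Fa_rtimes_Sym n)"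
  unfolding Fa_rtimes_Sym_def
proof (rule group_semidirect_product)
  fix s assume "s \<in> carrier (sym_group n)"
  then show "perm_action s \<in> hom (Fa n) (Fa n)"
    by (intro perm_action_hom) (simp only: sym_group_carrier)
qed (simp_all only: sym_group_is_group group_free_Abelian_group sym_group_mult sym_group_one
      perm_action_id perm_action_comp)

end

theory Submission
  imports Defs
begin

text \<open>
  Closure of the graph of \<open>\<phi>\<close> under the multiplication of the semidirect product is the single
  equation \<open>\<phi> (a + \<phi>(a) b) = \<phi>(a) \<circ> \<phi>(b)\<close>, and because \<open>\<phi>\<close> is total, this equation alone already
  makes the graph a subgroup (\<open>subgroup_graph_iff\<close>).  Hence the IYB property asks only for a solution
  of a functional equation whose values form the given group.

  Two solutions \<open>\<phi>1\<close>, \<open>\<phi>2\<close> in degrees \<open>n\<close>, \<open>m\<close> combine componentwise.  The basis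
  \<open>u\<^sub>1, \<dots>, u\<^bsub>n+m\<^esub>\<close> splits into a block of the first \<open>n\<close> and a block of the last \<open>m\<close> elements;
  accordingly \<open>Fa (n + m)\<close> projects onto \<open>Fa n\<close> and \<open>Fa m\<close>, and \<open>Sym\<^sub>n \<times> Sym\<^sub>m\<close> embeds in
  \<open>Sym\<^bsub>n+m\<^esub>\<close> as the block-preserving permutations (\<open>block_perm\<close>).  The map \<open>\<phi>\<close> sends \<open>a\<close> to the
  block permutation of the values of \<open>\<phi>1\<close>, \<open>\<phi>2\<close> at the two projections of \<open>a\<close>.  A block permutation
  acts on each projection through its own component, so the equation for \<open>\<phi>\<close> splits into those
  for \<open>\<phi>1\<close> and \<open>\<phi>2\<close>.  The pair of projections is onto, so the values of \<open>\<phi>\<close> are all block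
  permutations with components in the images of \<open>\<phi>1\<close> and \<open>\<phi>2\<close>, and they form the direct product
  of these images.
\<close>

section \<open>Graphs that are subgroups of the semidirect product\<close>

(* Unfolding membership in Fa n to a condition on keys, or 1 to Suc 0, would keep premises
   stated with carrier (Fa n) and {1..n} from matching. *)
declare carrier_free_Abelian_group_iff [simp del] One_nat_def [simp del]

lemma carrier_Fa_rtimes_Sym:
  "carrier (Fa_rtimes_Sym n) = carrier (Fa n) \<times> carrier (sym_group n)"
  by (simp add: Fa_rtimes_Sym_def semidirect_product_def)

lemma mult_Fa_rtimes_Sym:
  "(a, s) \<otimes>\<^bsub>Fa_rtimes_Sym n\<^esub> (b, t) = (a + perm_action s b, s \<circ> t)"
  by (simp add: Fa_rtimes_Sym_def semidirect_product_def sym_group_mult)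

lemma one_Fa_rtimes_Sym: "\<one>\<^bsub>Fa_rtimes_Sym n\<^esub> = (0, id)"
  by (simp add: Fa_rtimes_Sym_def semidirect_product_def sym_group_one)

lemma perm_action_in_Fa:
  assumes "s \<in> carrier (sym_group n)" "a \<in> carrier (Fa n)"
  shows "perm_action s a \<in> carrier (Fa n)"
  using perm_action_hom[of s n] assms by (auto simp: hom_def sym_group_carrier)

lemma add_in_Fa:
  assumes "a \<in> carrier (Fa n)" "b \<in> carrier (Fa n)"
  shows "a + b \<in> carrier (Fa n)"
  using monoid.m_closed[OF group.is_monoid[OF group_free_Abelian_group] assms] by simp

text \<open>
  Closure under inverses comes for free: the inverse of \<open>(a, s)\<close> has the form \<open>(b, t)\<close> with
  \<open>a + s b = 0\<close>, so the equation gives \<open>s \<circ> \<phi>(b) = \<phi>(0) = id\<close> and hence \<open>t = \<phi>(b)\<close>.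
\<close>

lemma subgroup_graph_iff:
  assumes \<phi>: "\<phi> \<in> carrier (Fa n) \<rightarrow> carrier (sym_group n)"
  shows "subgroup {(a, \<phi> a) | a. a \<in> carrier (Fa n)} (Fa_rtimes_Sym n) \<longleftrightarrow>
    (\<forall>a \<in> carrier (Fa n). \<forall>b \<in> carrier (Fa n). \<phi> (a + perm_action (\<phi> a) b) = \<phi> a \<circ> \<phi> b)"
    (is "subgroup ?S ?G \<longleftrightarrow> ?eq")
proof
  assume S: "subgroup ?S ?G"
  show ?eq
  proof (intro ballI)
    fix a b assume "a \<in> carrier (Fa n)" "b \<in> carrier (Fa n)"
    then have "(a, \<phi> a) \<otimes>\<^bsub>?G\<^esub> (b, \<phi> b) \<in> ?S"
      by (intro subgroup.m_closed[OF S]) auto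
    then show "\<phi> (a + perm_action (\<phi> a) b) = \<phi> a \<circ> \<phi> b"
      by (simp add: mult_Fa_rtimes_Sym)
  qed
next
  assume eq: ?eq
  interpret G: group ?G by (rule group_Fa_rtimes_Sym)
  have sub: "?S \<subseteq> carrier ?G"
    using \<phi> by (auto simp: carrier_Fa_rtimes_Sym)
  have zero: "0 \<in> carrier (Fa n)"
    by (simp add: carrier_free_Abelian_group_iff)
  have inj: "inj (\<phi> a)" if "a \<in> carrier (Fa n)" for a
    using permutes_inj funcset_mem[OF \<phi> that] by (simp only: sym_group_carrier)
  (* The equation at a = b = 0 says that \<phi> 0 is idempotent, hence trivial. *)
  have "\<phi> 0 \<circ> \<phi> 0 = \<phi> 0 \<circ> id"
    using eq zero by (auto simp: perm_action_def dest!: bspec[of _ _ 0])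
  then have \<phi>0: "\<phi> 0 = id"
    using inj[OF zero] by (metis comp_def ext id_apply injD)
  show "subgroup ?S ?G"
  proof (rule G.subgroupI[OF sub])
    show "?S \<noteq> {}" using zero by auto
  next
    fix x assume x: "x \<in> ?S"
    then obtain a where a: "a \<in> carrier (Fa n)" "x = (a, \<phi> a)" by auto
    obtain b t where bt: "inv\<^bsub>?G\<^esub> x = (b, t)" by fastforce
    have xG: "x \<in> carrier ?G" using sub x by auto
    have b: "b \<in> carrier (Fa n)"
      using G.inv_closed[OF xG] bt by (simp add: carrier_Fa_rtimes_Sym)
    have "a + perm_action (\<phi> a) b = 0" and t: "\<phi> a \<circ> t = id"
      using G.r_inv[OF xG] bt a(2) by (simp_all add: mult_Fa_rtimes_Sym one_Fa_rtimes_Sym)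
    then have "\<phi> a \<circ> \<phi> b = \<phi> a \<circ> t"
      using eq a(1) b \<phi>0 by metis
    then have "t = \<phi> b"
      using inj[OF a(1)] by (metis comp_apply ext injD)
    then show "inv\<^bsub>?G\<^esub> x \<in> ?S" using b bt by auto
  next
    fix x y assume "x \<in> ?S" "y \<in> ?S"
    then obtain a b where ab: "x = (a, \<phi> a)" "y = (b, \<phi> b)"
      "a \<in> carrier (Fa n)" "b \<in> carrier (Fa n)" by auto
    then have "a + perm_action (\<phi> a) b \<in> carrier (Fa n)"
      using \<phi> by (intro add_in_Fa perm_action_in_Fa) auto
    then show "x \<otimes>\<^bsub>?G\<^esub> y \<in> ?S"
      using ab eq by (auto simp: mult_Fa_rtimes_Sym)
  qed
qed

section \<open>Block permutations\<close>

text \<open>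
  Since permutations fix the indices outside their degree, the two cases need no further
  bounds: index 0 is fixed by \<open>\<sigma>\<close>, and indices beyond both blocks are fixed by \<open>\<tau>\<close>.
\<close>

definition block_perm :: "nat \<Rightarrow> (nat \<Rightarrow> nat) \<Rightarrow> (nat \<Rightarrow> nat) \<Rightarrow> nat \<Rightarrow> nat"
  where "block_perm n \<sigma> \<tau> i = (if i \<le> n then \<sigma> i else \<tau> (i - n) + n)"

lemma permutes_le_iff:
  assumes "\<sigma> permutes {1..n::nat}"
  shows "\<sigma> i \<le> n \<longleftrightarrow> i \<le> n"
proof (cases "i \<in> {1..n}")
  case True
  then show ?thesis using permutes_in_image[OF assms, of i] by auto
next
  case False
  then show ?thesis using permutes_not_in[OF assms] by auto
qed

lemma permutes_eq_0_iff:
  assumes "\<tau> permutes {1..m::nat}"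
  shows "\<tau> j = 0 \<longleftrightarrow> j = 0"
proof (cases "j \<in> {1..m}")
  case True
  then show ?thesis using permutes_in_image[OF assms, of j] by auto
next
  case False
  then show ?thesis using permutes_not_in[OF assms] by auto
qed

lemma block_perm_comp:
  assumes "\<sigma>' permutes {1..n}" "\<tau>' permutes {1..m}"
  shows "block_perm n \<sigma> \<tau> \<circ> block_perm n \<sigma>' \<tau>' = block_perm n (\<sigma> \<circ> \<sigma>') (\<tau> \<circ> \<tau>')"
proof
  fix i
  show "(block_perm n \<sigma> \<tau> \<circ> block_perm n \<sigma>' \<tau>') i = block_perm n (\<sigma> \<circ> \<sigma>') (\<tau> \<circ> \<tau>') i"
    using permutes_le_iff[OF assms(1), of i] permutes_eq_0_iff[OF assms(2), of "i - n"]
    by (auto simp: block_perm_def)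
qed

lemma block_perm_id: "block_perm n id id = id"
  by (auto simp: block_perm_def)

lemma block_perm_permutes:
  assumes "\<sigma> permutes {1..n}" "\<tau> permutes {1..m}"
  shows "block_perm n \<sigma> \<tau> permutes {1..n + m}"
proof -
  have inv: "inv' \<sigma> permutes {1..n}" "inv' \<tau> permutes {1..m}"
    using assms by (auto intro: permutes_inv)
  have "bij (block_perm n \<sigma> \<tau>)"
  proof (rule o_bij)
    show "block_perm n (inv' \<sigma>) (inv' \<tau>) \<circ> block_perm n \<sigma> \<tau> = id"
      using assms by (simp add: block_perm_comp permutes_inv_o block_perm_id)
    show "block_perm n \<sigma> \<tau> \<circ> block_perm n (inv' \<sigma>) (inv' \<tau>) = id"
      using assms inv by (simp add: block_perm_comp permutes_inv_o block_perm_id)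
  qed
  moreover have "block_perm n \<sigma> \<tau> i = i" if "i \<notin> {1..n + m}" for i
  proof (cases "i \<le> n")
    case True
    then show ?thesis
      using that permutes_not_in[OF assms(1), of i] by (simp add: block_perm_def)
  next
    case False
    then have "i - n \<notin> {1..m}" using that by auto
    then show ?thesis
      using False permutes_not_in[OF assms(2)] by (simp add: block_perm_def)
  qed
  ultimately show ?thesis by (simp add: permutes_def bij_iff)
qed

lemma block_perm_eq_iff:
  assumes "\<sigma> permutes {1..n}" "\<sigma>' permutes {1..n}" "\<tau> permutes {1..m}" "\<tau>' permutes {1..m}"
  shows "block_perm n \<sigma> \<tau> = block_perm n \<sigma>' \<tau>' \<longleftrightarrow> \<sigma> = \<sigma>' \<and> \<tau> = \<tau>'"
proof
  assume eq: "block_perm n \<sigma> \<tau> = block_perm n \<sigma>' \<tau>'"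
  have "\<sigma> i = \<sigma>' i" for i
    using fun_cong[OF eq, of i] permutes_not_in[OF assms(1), of i] permutes_not_in[OF assms(2), of i]
    by (cases "i \<le> n") (auto simp: block_perm_def)
  moreover have "\<tau> j = \<tau>' j" for j
    using fun_cong[OF eq, of "j + n"] permutes_not_in[OF assms(3), of 0]
      permutes_not_in[OF assms(4), of 0]
    by (cases "j = 0") (auto simp: block_perm_def)
  ultimately show "\<sigma> = \<sigma>' \<and> \<tau> = \<tau>'" by auto
qed auto

section \<open>Splitting the free abelian group into two blocks\<close>

definition fst_block :: "nat \<Rightarrow> (nat \<Rightarrow>\<^sub>0 int) \<Rightarrow> (nat \<Rightarrow>\<^sub>0 int)"
  where "fst_block n = frag_extend (\<lambda>i. if i \<le> n then frag_of i else 0)"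

definition snd_block :: "nat \<Rightarrow> (nat \<Rightarrow>\<^sub>0 int) \<Rightarrow> (nat \<Rightarrow>\<^sub>0 int)"
  where "snd_block n = frag_extend (\<lambda>i. if i \<le> n then 0 else frag_of (i - n))"

definition shift_block :: "nat \<Rightarrow> (nat \<Rightarrow>\<^sub>0 int) \<Rightarrow> (nat \<Rightarrow>\<^sub>0 int)"
  where "shift_block n = frag_extend (\<lambda>i. frag_of (i + n))"

lemma fst_block_add: "fst_block n (a + b) = fst_block n a + fst_block n b"
  by (simp add: fst_block_def frag_extend_add)

lemma snd_block_add: "snd_block n (a + b) = snd_block n a + snd_block n b"
  by (simp add: snd_block_def frag_extend_add)

lemma fst_block_in_Fa: "a \<in> carrier (Fa (n + m)) \<Longrightarrow> fst_block n a \<in> carrier (Fa n)"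
  unfolding fst_block_def carrier_free_Abelian_group_iff
  by (rule order_trans[OF keys_frag_extend]) (auto split: if_splits)

lemma snd_block_in_Fa: "a \<in> carrier (Fa (n + m)) \<Longrightarrow> snd_block n a \<in> carrier (Fa m)"
  unfolding snd_block_def carrier_free_Abelian_group_iff
  by (rule order_trans[OF keys_frag_extend]) (fastforce split: if_splits)

lemma shift_block_in_Fa: "a \<in> carrier (Fa m) \<Longrightarrow> shift_block n a \<in> carrier (Fa (n + m))"
  unfolding shift_block_def carrier_free_Abelian_group_iff
  by (rule order_trans[OF keys_frag_extend]) fastforce

lemma frag_extend_frag_extend:
  "frag_extend g (frag_extend f a) = frag_extend (\<lambda>i. frag_extend g (f i)) a"
  using subset_UNIV
  by (induction a rule: frag_induction) (simp_all add: frag_extend_diff)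

text \<open>
  These two identities are why componentwise combination respects the action: a block permutation
  moves no basis element from one block to the other.
\<close>

lemma fst_block_perm_action:
  assumes "\<sigma> permutes {1..n}" "\<tau> permutes {1..m}"
  shows "fst_block n (perm_action (block_perm n \<sigma> \<tau>) a) = perm_action \<sigma> (fst_block n a)"
  using permutes_le_iff[OF assms(1)] permutes_eq_0_iff[OF assms(2)]
  by (auto simp: fst_block_def perm_action_def frag_extend_frag_extend block_perm_def
      intro!: frag_extend_eq)

lemma snd_block_perm_action:
  assumes "\<sigma> permutes {1..n}" "\<tau> permutes {1..m}"
  shows "snd_block n (perm_action (block_perm n \<sigma> \<tau>) a) = perm_action \<tau> (snd_block n a)"
  using permutes_le_iff[OF assms(1)] permutes_eq_0_iff[OF assms(2)]
  by (auto simp: snd_block_def perm_action_def frag_extend_frag_extend block_perm_def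
      intro!: frag_extend_eq)

lemma blocks_surj:
  assumes a: "a \<in> carrier (Fa n)" and b: "b \<in> carrier (Fa m)"
  obtains c where "c \<in> carrier (Fa (n + m))" "fst_block n c = a" "snd_block n c = b"
proof
  let ?c = "a + shift_block n b"
  have keys: "Poly_Mapping.keys a \<subseteq> {1..n}" "Poly_Mapping.keys b \<subseteq> {1..m}"
    using a b by (auto simp: carrier_free_Abelian_group_iff)
  have "a \<in> carrier (Fa (n + m))"
    using a by (auto simp: carrier_free_Abelian_group_iff)
  then show "?c \<in> carrier (Fa (n + m))"
    using b by (intro add_in_Fa shift_block_in_Fa)
  have "fst_block n a = frag_extend frag_of a" "snd_block n a = frag_extend (\<lambda>_. 0) a"
    unfolding fst_block_def snd_block_def using keys by (auto intro!: frag_extend_eq)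
  moreover have "fst_block n (shift_block n b) = frag_extend (\<lambda>_. 0) b"
    "snd_block n (shift_block n b) = frag_extend frag_of b"
    unfolding fst_block_def snd_block_def shift_block_def frag_extend_frag_extend
    using keys by (auto intro!: frag_extend_eq)
  ultimately show "fst_block n ?c = a" "snd_block n ?c = b"
    by (simp_all add: fst_block_add snd_block_add frag_expansion[symmetric] frag_extend_eq_0)
qed

section \<open>Closure under direct products\<close>

theorem corollary3p2:
  fixes G1 :: "('a, 'm) monoid_scheme" and G2 :: "('b, 'k) monoid_scheme"
  assumes "IYB_group G1" and "IYB_group G2"
  shows "IYB_group (G1 \<times>\<times> G2)"
proof -
  from assms obtain n \<phi>1 m \<phi>2 where
    G: "group G1" "finite (carrier G1)" "group G2" "finite (carrier G2)" and "n > 0" and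
    \<phi>1: "\<phi>1 \<in> carrier (Fa n) \<rightarrow> carrier (sym_group n)" and
    \<phi>2: "\<phi>2 \<in> carrier (Fa m) \<rightarrow> carrier (sym_group m)" and
    "subgroup {(a, \<phi>1 a) | a. a \<in> carrier (Fa n)} (Fa_rtimes_Sym n)"
    "subgroup {(a, \<phi>2 a) | a. a \<in> carrier (Fa m)} (Fa_rtimes_Sym m)" and
    iso: "G1 \<cong> (sym_group n)\<lparr>carrier := \<phi>1 ` carrier (Fa n)\<rparr>"
      "G2 \<cong> (sym_group m)\<lparr>carrier := \<phi>2 ` carrier (Fa m)\<rparr>"
    unfolding IYB_group_def by blast
  then have eq1: "\<And>a b. a \<in> carrier (Fa n) \<Longrightarrow> b \<in> carrier (Fa n) \<Longrightarrow>
      \<phi>1 (a + perm_action (\<phi>1 a) b) = \<phi>1 a \<circ> \<phi>1 b"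
    and eq2: "\<And>a b. a \<in> carrier (Fa m) \<Longrightarrow> b \<in> carrier (Fa m) \<Longrightarrow>
      \<phi>2 (a + perm_action (\<phi>2 a) b) = \<phi>2 a \<circ> \<phi>2 b"
    using subgroup_graph_iff[OF \<phi>1] subgroup_graph_iff[OF \<phi>2] by blast+
  have perm1: "\<phi>1 a permutes {1..n}" if "a \<in> carrier (Fa n)" for a
    using \<phi>1 that by (auto simp: sym_group_carrier)
  have perm2: "\<phi>2 a permutes {1..m}" if "a \<in> carrier (Fa m)" for a
    using \<phi>2 that by (auto simp: sym_group_carrier)
  note in1 = fst_block_in_Fa[of _ n m] and in2 = snd_block_in_Fa[of _ n m]

  define \<phi> where "\<phi> a = block_perm n (\<phi>1 (fst_block n a)) (\<phi>2 (snd_block n a))" for a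
  have \<phi>: "\<phi> \<in> carrier (Fa (n + m)) \<rightarrow> carrier (sym_group (n + m))"
    using block_perm_permutes perm1[OF in1] perm2[OF in2] by (auto simp: \<phi>_def sym_group_carrier)
  have "\<phi> (a + perm_action (\<phi> a) b) = \<phi> a \<circ> \<phi> b"
    if "a \<in> carrier (Fa (n + m))" "b \<in> carrier (Fa (n + m))" for a b
  proof -
    note [simp] = in1[OF that(1)] in1[OF that(2)] in2[OF that(1)] in2[OF that(2)]
    show ?thesis
      by (simp add: \<phi>_def fst_block_add snd_block_add fst_block_perm_action[OF perm1 perm2]
          snd_block_perm_action[OF perm1 perm2] eq1 eq2 block_perm_comp[OF perm1 perm2])
  qed
  then have sub: "subgroup {(a, \<phi> a) | a. a \<in> carrier (Fa (n + m))} (Fa_rtimes_Sym (n + m))"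
    unfolding subgroup_graph_iff[OF \<phi>] by blast

  let ?S1 = "\<phi>1 ` carrier (Fa n)" and ?S2 = "\<phi>2 ` carrier (Fa m)"
  let ?S = "\<phi> ` carrier (Fa (n + m))"
  have image: "?S = (\<lambda>(\<sigma>, \<tau>). block_perm n \<sigma> \<tau>) ` (?S1 \<times> ?S2)"
  proof
    show "?S \<subseteq> (\<lambda>(\<sigma>, \<tau>). block_perm n \<sigma> \<tau>) ` (?S1 \<times> ?S2)"
      using in1 in2 by (auto simp: \<phi>_def)
    show "(\<lambda>(\<sigma>, \<tau>). block_perm n \<sigma> \<tau>) ` (?S1 \<times> ?S2) \<subseteq> ?S"
    proof clarify
      fix a b assume "a \<in> carrier (Fa n)" "b \<in> carrier (Fa m)"
      then obtain c where "c \<in> carrier (Fa (n + m))" "fst_block n c = a" "snd_block n c = b"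
        by (rule blocks_surj)
      then show "block_perm n (\<phi>1 a) (\<phi>2 b) \<in> ?S" by (auto simp: \<phi>_def image_iff)
    qed
  qed
  have "(\<lambda>(\<sigma>, \<tau>). block_perm n \<sigma> \<tau>) \<in>
      iso ((sym_group n)\<lparr>carrier := ?S1\<rparr> \<times>\<times> (sym_group m)\<lparr>carrier := ?S2\<rparr>)
        ((sym_group (n + m))\<lparr>carrier := ?S\<rparr>)"
  proof (rule isoI)
    show "(\<lambda>(\<sigma>, \<tau>). block_perm n \<sigma> \<tau>) \<in>
        hom ((sym_group n)\<lparr>carrier := ?S1\<rparr> \<times>\<times> (sym_group m)\<lparr>carrier := ?S2\<rparr>)
          ((sym_group (n + m))\<lparr>carrier := ?S\<rparr>)"
      unfolding image
      by (rule homI) (auto simp: sym_group_mult block_perm_comp[OF perm1 perm2])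
    have "inj_on (\<lambda>(\<sigma>, \<tau>). block_perm n \<sigma> \<tau>) (?S1 \<times> ?S2)"
      by (rule inj_onI) (auto simp: block_perm_eq_iff[OF perm1 perm1 perm2 perm2])
    then show "bij_betw (\<lambda>(\<sigma>, \<tau>). block_perm n \<sigma> \<tau>)
        (carrier ((sym_group n)\<lparr>carrier := ?S1\<rparr> \<times>\<times> (sym_group m)\<lparr>carrier := ?S2\<rparr>))
        (carrier ((sym_group (n + m))\<lparr>carrier := ?S\<rparr>))"
      by (simp add: image bij_betw_def)
  qed
  then have "G1 \<times>\<times> G2 \<cong> (sym_group (n + m))\<lparr>carrier := ?S\<rparr>"
    using group.DirProd_iso_trans[OF G(1) iso] by (blast intro: iso_trans is_isoI)
  then show ?thesis
    unfolding IYB_group_def using G \<open>n > 0\<close> \<phi> sub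
    by (auto simp: DirProd_group intro!: exI[of _ "n + m"] bexI[of _ \<phi>])
qed

end
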